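(* Let $G$ be a $\Delta$-regular simple graph on $n$ vertices and let $G^\sigma$ be an oriented graph of $G$ with skew adjacency matrix $S$. Then $\rho_s(G^\sigma)=\sqrt{\Delta}$ if and only if $S^TS=\Delta I_n$, i.e., if and only if $G^\sigma$ has optimum skew energy $\mathcal{E}_s(G^\sigma)=n\sqrt{\Delta}$.
   Context: An oriented graph $G^\sigma$ of a simple graph $G$ on vertices $v_1,\dots,v_n$ is obtained by giving each edge of $G$ one of its two directions. Its skew adjacency matrix $S=(s_{ij})$ has $s_{ij}=1$, $s_{ji}=-1$ if $\langle v_i,v_j\rangle$ is an arc, and $s_{ij}=s_{ji}=0$ otherwise. The skew spectral radius $\rho_s(G^\sigma)$ is the spectral radius of $S$. The skew energy $\mathcal{E}_s(G^\sigma)$ is the sum of the moduli of all eigenvalues of $S$; it is known that $\mathcal{E}_s(G^\sigma)\le n\sqrt{\Delta}$, and $G^\sigma$ is said to have optimum skew energy when equality holds, which is equivalent to $S^TS=\Delta I_n$. *)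

theory Defs
  imports
    "HOL-Computational_Algebra.Polynomial"
    "Graph_Theory.Pair_Digraph"
    "Jordan_Normal_Form.Spectral_Radius"
begin

text \<open>
  A finite simple graph is a \<^locale>\<open>pair_graph\<close>: a finite loop-free symmetric digraph
  without parallel arcs, in which an edge \<open>{u, w}\<close> is represented by the two arcs
  \<open>(u, w)\<close> and \<open>(w, u)\<close>. Hence the degree of a vertex in the simple graph is its
  \<^const>\<open>out_degree\<close>.
\<close>

definition regular_graph :: "'a pair_pre_digraph \<Rightarrow> nat \<Rightarrow> bool" where
  "regular_graph G \<Delta> \<longleftrightarrow> (\<forall>u \<in> pverts G. out_degree (with_proj G) u = \<Delta>)"

definition max_degree :: "'a pair_pre_digraph \<Rightarrow> nat" where
  "max_degree G = Max (out_degree (with_proj G) ` pverts G)"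

text \<open>Exactly one of the two arcs representing each edge of \<open>G\<close> is kept in \<open>H\<close>.\<close>

definition orientation_of :: "'a pair_pre_digraph \<Rightarrow> 'a pair_pre_digraph \<Rightarrow> bool" where
  "orientation_of G H \<longleftrightarrow>
     pverts H = pverts G \<and> parcs H \<subseteq> parcs G \<and>
     (\<forall>(u, w) \<in> parcs G. (u, w) \<in> parcs H \<longleftrightarrow> (w, u) \<notin> parcs H)"

text \<open>
  The function \<open>v\<close> enumerates the vertices as \<open>v 0, \<dots>, v (n - 1)\<close>. The eigenvalues of the
  real skew adjacency matrix are its complex ones.
\<close>

definition skew_adjacency_matrix ::
    "'a pair_pre_digraph \<Rightarrow> (nat \<Rightarrow> 'a) \<Rightarrow> nat \<Rightarrow> real mat" where
  "skew_adjacency_matrix H v n = mat n n (\<lambda>(i, j).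
     if (v i, v j) \<in> parcs H then 1
     else if (v j, v i) \<in> parcs H then - 1
     else 0)"

definition skew_spectral_radius ::
    "'a pair_pre_digraph \<Rightarrow> (nat \<Rightarrow> 'a) \<Rightarrow> nat \<Rightarrow> real" where
  "skew_spectral_radius H v n =
     spectral_radius (map_mat complex_of_real (skew_adjacency_matrix H v n))"

text \<open>\<^const>\<open>proots\<close> is a multiset, so eigenvalues count with algebraic multiplicity.\<close>

definition skew_energy ::
    "'a pair_pre_digraph \<Rightarrow> (nat \<Rightarrow> 'a) \<Rightarrow> nat \<Rightarrow> real" where
  "skew_energy H v n =
     (\<Sum>z \<in># proots (char_poly (map_mat complex_of_real (skew_adjacency_matrix H v n))). cmod z)"

text \<open>Equality in the general bound on the skew energy of an orientation \<open>H\<close> of \<open>G\<close>.\<close>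

definition optimum_skew_energy ::
    "'a pair_pre_digraph \<Rightarrow> 'a pair_pre_digraph \<Rightarrow> (nat \<Rightarrow> 'a) \<Rightarrow> nat \<Rightarrow> bool" where
  "optimum_skew_energy G H v n \<longleftrightarrow>
     skew_energy H v n = real n * sqrt (real (max_degree G))"

end

theory Submission
  imports Defs
begin

text \<open>
  Let \<open>\<lambda>\<^sub>1, \<dots>, \<lambda>\<^sub>n\<close> be the complex eigenvalues of the real skew-symmetric matrix \<open>S\<close>. They are
  purely imaginary, so \<open>\<bar>\<lambda>\<^sub>k\<bar>\<^sup>2 = - \<lambda>\<^sub>k\<^sup>2\<close>, and the traces of \<open>S\<^sup>2\<close> and \<open>S\<^sup>4\<close> give
  \<open>\<Sum>\<bar>\<lambda>\<^sub>k\<bar>\<^sup>2 = tr (S\<^sup>T S)\<close> and \<open>\<Sum>(\<bar>\<lambda>\<^sub>k\<bar>\<^sup>2 - c)\<^sup>2 = \<parallel>S\<^sup>T S - c I\<parallel>\<^sup>2\<close> in the Frobenius norm. Hence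
  \<open>S\<^sup>T S = \<Delta> I\<close> holds iff all \<open>\<bar>\<lambda>\<^sub>k\<bar>\<close> equal \<open>\<surd>\<Delta>\<close>. As \<open>\<Sum>\<bar>\<lambda>\<^sub>k\<bar>\<^sup>2 = n \<Delta>\<close> by regularity, this is forced
  if \<open>\<surd>\<Delta>\<close> is the largest modulus, and also if it is the mean modulus, since then
  \<open>\<Sum>(\<bar>\<lambda>\<^sub>k\<bar> - \<surd>\<Delta>)\<^sup>2 = 0\<close>.
\<close>

section \<open>Traces of matrix powers as power sums of eigenvalues\<close>

definition trace_mat :: "'a :: comm_semiring_1 mat \<Rightarrow> 'a" where
  "trace_mat A = (\<Sum>i = 0..<dim_row A. A $$ (i, i))"

lemma trace_mat_mult:
  assumes "A \<in> carrier_mat n m" "B \<in> carrier_mat m n"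
  shows "trace_mat (A * B) = (\<Sum>i = 0..<n. \<Sum>j = 0..<m. A $$ (i, j) * B $$ (j, i))"
  using assms unfolding trace_mat_def by (auto simp: scalar_prod_def intro!: sum.cong)

lemma trace_mat_mult_comm:
  assumes "A \<in> carrier_mat n m" "B \<in> carrier_mat m n"
  shows "trace_mat (A * B) = trace_mat (B * A)"
  unfolding trace_mat_mult[OF assms] trace_mat_mult[OF assms(2,1)]
  by (subst sum.swap) (simp add: mult.commute)

text \<open>Cyclicity of the trace moves \<open>P\<close> behind \<open>B * Q\<close>, where
  \<open>Q * P\<close> cancels.\<close>

lemma trace_mat_similar:
  assumes "similar_mat_wit A B P Q"
  shows "trace_mat A = trace_mat B"
proof -
  note AB = similar_mat_witD[OF refl assms]
  have "trace_mat A = trace_mat (P * (B * Q))"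
    by (subst AB(3), subst assoc_mult_mat[OF AB(6,5,7)]) (rule refl)
  also have "\<dots> = trace_mat (B * Q * P)"
    by (rule trace_mat_mult_comm[OF AB(6) mult_carrier_mat[OF AB(5,7)]])
  also have "B * Q * P = B"
    unfolding assoc_mult_mat[OF AB(5,7,6)] AB(2) by (rule right_mult_one_mat[OF AB(5)])
  finally show ?thesis .
qed

lemma upper_triangular_mult:
  fixes A B :: "'a :: comm_semiring_1 mat"
  assumes "A \<in> carrier_mat n n" "B \<in> carrier_mat n n" "upper_triangular A" "upper_triangular B"
  shows "upper_triangular (A * B)"
    and "i < n \<Longrightarrow> (A * B) $$ (i, i) = A $$ (i, i) * B $$ (i, i)"
proof -
  \<comment> \<open>A nonzero product requires \<open>i \<le> k \<le> j\<close>; together with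
    \<open>j \<le> i\<close> only \<open>k = i = j\<close> survives.\<close>
  have entry: "A $$ (i, k) * B $$ (k, j) = 0" if "i < n" "k < n" "j \<le> i" "k \<noteq> i \<or> j < i" for i j k
  proof (cases "k < i")
    case True
    then show ?thesis using that assms by (simp add: upper_triangularD)
  next
    case False
    with that have "j < k" by auto
    then show ?thesis using that assms by (simp add: upper_triangularD)
  qed
  show "upper_triangular (A * B)"
    using assms(1,2) entry by (intro upper_triangularI) (auto simp: scalar_prod_def)
  show "(A * B) $$ (i, i) = A $$ (i, i) * B $$ (i, i)" if "i < n"
  proof -
    have "(A * B) $$ (i, i) = (\<Sum>k = 0..<n. A $$ (i, k) * B $$ (k, i))"
      using assms(1,2) that by (auto simp: scalar_prod_def)
    also have "\<dots> = (\<Sum>k = 0..<n. if k = i then A $$ (i, i) * B $$ (i, i) else 0)"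
      using entry that by (intro sum.cong) auto
    finally show ?thesis using that by simp
  qed
qed

lemma upper_triangular_pow:
  fixes A :: "'a :: comm_semiring_1 mat"
  assumes A: "A \<in> carrier_mat n n" and tri: "upper_triangular A"
  shows "upper_triangular (A ^\<^sub>m k) \<and> (\<forall>i<n. (A ^\<^sub>m k) $$ (i, i) = (A $$ (i, i)) ^ k)"
proof (induction k)
  case 0
  then show ?case using A by simp
next
  case (Suc k)
  then show ?case
    using upper_triangular_mult[OF pow_carrier_mat[OF A] A _ tri] by (simp add: mult.commute)
qed

text \<open>Schur triangularization makes \<open>A\<close> similar to an upper triangular matrix
  with diagonal \<open>es\<close>. Powers preserve the similarity and act entrywise on that
  diagonal, so each eigenvalue enters with its algebraic multiplicity.\<close>

lemma trace_mat_pow: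
  fixes A :: "'a :: conjugatable_ordered_field mat"
  assumes A: "A \<in> carrier_mat n n" and es: "char_poly A = (\<Prod>e\<leftarrow>es. [:- e, 1:])"
  shows "trace_mat (A ^\<^sub>m k) = (\<Sum>e\<leftarrow>es. e ^ k)"
proof -
  obtain B P Q where schur: "schur_decomposition A es = (B, P, Q)"
    by (cases "schur_decomposition A es") auto
  have sim: "similar_mat_wit A B P Q" and tri: "upper_triangular B" and diag: "diag_mat B = es"
    using schur_decomposition[OF A es schur] by auto
  have B: "B \<in> carrier_mat n n"
    using similar_mat_witD2[OF A sim] by blast
  have "trace_mat (A ^\<^sub>m k) = trace_mat (B ^\<^sub>m k)"
    by (rule trace_mat_similar[OF similar_mat_wit_pow[OF sim]])
  also have "\<dots> = (\<Sum>i = 0..<n. (B $$ (i, i)) ^ k)"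
    using upper_triangular_pow[OF B tri, of k] B by (simp add: trace_mat_def)
  also have "\<dots> = (\<Sum>e\<leftarrow>es. e ^ k)"
    using B unfolding diag[symmetric]
    by (simp add: diag_mat_def o_def interv_sum_list_conv_sum_set_nat)
  finally show ?thesis .
qed

section \<open>Real skew-symmetric matrices have purely imaginary spectrum\<close>

text \<open>For an eigenvector \<open>x\<close>, the Hermitian form \<open>q\<close> of
  \<open>S\<close> at \<open>x\<close> equals \<open>k\<close> times the squared norm of
  \<open>x\<close>. Conjugation negates \<open>q\<close>, so its real part vanishes.\<close>

lemma Re_eigenvalue_skew_symmetric:
  fixes S :: "real mat"
  assumes S: "S \<in> carrier_mat n n" and skew: "transpose_mat S = - S"
    and ev: "eigenvalue (map_mat complex_of_real S) k"
  shows "Re k = 0"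
proof -
  obtain x where x: "x \<in> carrier_vec n" "x \<noteq> 0\<^sub>v n"
    and Ax: "map_mat complex_of_real S *\<^sub>v x = k \<cdot>\<^sub>v x"
    using ev S unfolding eigenvalue_def eigenvector_def by auto
  have S_swap: "S $$ (i, j) = - S $$ (j, i)" if "i < n" "j < n" for i j
    using that S arg_cong[OF skew, of "\<lambda>M. M $$ (j, i)"] by simp
  have row: "(\<Sum>j = 0..<n. of_real (S $$ (i, j)) * x $ j) = k * x $ i" if "i < n" for i
    using that S x(1) arg_cong[OF Ax, of "\<lambda>w. w $ i"] by (simp add: scalar_prod_def)
  define N where "N = (\<Sum>i = 0..<n. (cmod (x $ i))\<^sup>2)"
  define q where "q = (\<Sum>i = 0..<n. \<Sum>j = 0..<n. of_real (S $$ (i, j)) * x $ j * cnj (x $ i))"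
  have "q = (\<Sum>i = 0..<n. k * x $ i * cnj (x $ i))"
    unfolding q_def using row by (simp flip: sum_distrib_right)
  also have "\<dots> = k * of_real N"
    unfolding N_def of_real_sum sum_distrib_left
    by (intro sum.cong) (simp_all only: complex_norm_square mult.assoc)
  finally have q: "q = k * of_real N" .
  \<comment> \<open>Once the sums are swapped, skew symmetry turns each term into minus a term of
    \<open>q\<close> with the index names exchanged.\<close>
  have "cnj q = (\<Sum>j = 0..<n. \<Sum>i = 0..<n. of_real (S $$ (i, j)) * cnj (x $ j) * x $ i)"
    unfolding q_def by (subst sum.swap) simp
  also have "\<dots> = (\<Sum>j = 0..<n. \<Sum>i = 0..<n. - (of_real (S $$ (j, i)) * x $ i * cnj (x $ j)))"
  proof (intro sum.cong refl)
    fix i j assume "j \<in> {0..<n}" "i \<in> {0..<n}"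
    then have "S $$ (i, j) = - S $$ (j, i)" by (intro S_swap) auto
    then show "of_real (S $$ (i, j)) * cnj (x $ j) * x $ i
        = - (of_real (S $$ (j, i)) * x $ i * cnj (x $ j))"
      by simp
  qed
  also have "\<dots> = - q"
    unfolding q_def by (simp add: sum_negf)
  finally have "Re (cnj q) = Re (- q)" by (rule arg_cong)
  then have "Re k * N = 0" using q by simp
  moreover have "N \<noteq> 0"
  proof
    assume "N = 0"
    then have "\<forall>i\<in>{0..<n}. (cmod (x $ i))\<^sup>2 = 0"
      unfolding N_def by (subst (asm) sum_nonneg_eq_0_iff) auto
    then have "x = 0\<^sub>v n" using x(1) by (intro eq_vecI) auto
    with x(2) show False by simp
  qed
  ultimately show ?thesis by simp
qed

text \<open>Serves twice: for the deviation of the squared moduli from \<open>c\<close>, and for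
  that of the moduli from \<open>sqrt c\<close>.\<close>

lemma sum_list_diff_square:
  fixes f :: "'a \<Rightarrow> real"
  shows "(\<Sum>x\<leftarrow>xs. (f x - r)\<^sup>2)
    = (\<Sum>x\<leftarrow>xs. (f x)\<^sup>2) - 2 * r * (\<Sum>x\<leftarrow>xs. f x) + real (length xs) * r\<^sup>2"
  by (induction xs) (simp_all add: power2_diff distrib_left distrib_right)

lemma sum_list_square_eq_0_iff:
  fixes f :: "'a \<Rightarrow> real"
  shows "(\<Sum>x\<leftarrow>xs. (f x)\<^sup>2) = 0 \<longleftrightarrow> (\<forall>x\<in>set xs. f x = 0)"
  by (subst sum_list_nonneg_eq_0_iff) auto

section \<open>Eigenvalue moduli and the Gram matrix\<close>

context
  fixes S :: "real mat" and n :: nat and es :: "complex list"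
  assumes S: "S \<in> carrier_mat n n" and skew: "transpose_mat S = - S"
    and es: "char_poly (map_mat complex_of_real S) = (\<Prod>e\<leftarrow>es. [:- e, 1:])"
begin

text \<open>Since \<open>e\<close> is purely imaginary, even powers of its modulus are, up to sign,
  powers of \<open>e\<close> itself. This brings sums of such powers within reach of traces.\<close>

lemma skew_eigenvalue_square:
  assumes "e \<in> set es"
  shows "e\<^sup>2 = - of_real ((cmod e)\<^sup>2)"
proof -
  have "eigenvalue (map_mat complex_of_real S) e"
    using S assms by (subst eigenvalue_root_char_poly[of _ n]) (auto simp: es linear_poly_root)
  then have "Re e = 0" using Re_eigenvalue_skew_symmetric[OF S skew] by blast
  then show ?thesis
    by (simp add: complex_eq_iff Re_power2 Im_power2 cmod_power2)
qed

lemma trace_mat_pow_skew: "complex_of_real (trace_mat (S ^\<^sub>m k)) = (\<Sum>e\<leftarrow>es. e ^ k)"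
proof -
  have "complex_of_real (trace_mat (S ^\<^sub>m k)) = trace_mat (map_mat complex_of_real (S ^\<^sub>m k))"
    using S by (simp add: trace_mat_def)
  also have "\<dots> = (\<Sum>e\<leftarrow>es. e ^ k)"
    unfolding of_real_hom.mat_hom_pow[OF S] using S by (intro trace_mat_pow[OF _ es]) auto
  finally show ?thesis .
qed

text \<open>The zeroth power sum counts \<open>es\<close>, and the zeroth power of \<open>S\<close>
  is the identity, of trace \<open>n\<close>.\<close>

lemma length_skew_eigenvalues: "length es = n"
proof -
  have "of_nat n = complex_of_real (trace_mat (S ^\<^sub>m 0))"
    using S by (simp add: trace_mat_def)
  also have "\<dots> = of_nat (length es)"
    unfolding trace_mat_pow_skew by (simp add: sum_list_triv)
  finally show ?thesis using of_nat_eq_iff by metis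
qed

lemma sum_norm_square_skew_eigenvalues:
  "(\<Sum>e\<leftarrow>es. (cmod e)\<^sup>2) = trace_mat (transpose_mat S * S)"
proof -
  have "complex_of_real (\<Sum>e\<leftarrow>es. (cmod e)\<^sup>2) = (\<Sum>e\<leftarrow>es. - e\<^sup>2)"
    using skew_eigenvalue_square
    by (simp add: of_real_hom.hom_sum_list o_def cong: map_cong)
  also have "\<dots> = - (\<Sum>e\<leftarrow>es. e\<^sup>2)"
    by (simp add: uminus_sum_list_map o_def)
  also have "\<dots> = - complex_of_real (trace_mat (S ^\<^sub>m 2))"
    by (simp add: trace_mat_pow_skew)
  also have "\<dots> = complex_of_real (trace_mat (transpose_mat S * S))"
    using S unfolding skew by (simp add: numeral_2_eq_2 trace_mat_def sum_negf)
  finally show ?thesis by (simp only: of_real_eq_iff)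
qed

text \<open>By skew symmetry \<open>N\<close> is minus the square of \<open>S\<close>, so the fourth
  power of \<open>S\<close> is \<open>N * N\<close>. As \<open>N\<close> is symmetric, the trace of
  \<open>N * N\<close> is its squared Frobenius norm.\<close>

lemma sum_norm_power4_skew_eigenvalues:
  defines "N \<equiv> transpose_mat S * S"
  shows "(\<Sum>e\<leftarrow>es. ((cmod e)\<^sup>2)\<^sup>2) = (\<Sum>i = 0..<n. \<Sum>j = 0..<n. (N $$ (i, j))\<^sup>2)"
proof -
  have sq: "complex_of_real (((cmod e)\<^sup>2)\<^sup>2) = e ^ 4" if "e \<in> set es" for e
  proof -
    have "e ^ 4 = (e\<^sup>2)\<^sup>2" by simp
    then show ?thesis unfolding skew_eigenvalue_square[OF that] by simp
  qed
  have "complex_of_real (\<Sum>e\<leftarrow>es. ((cmod e)\<^sup>2)\<^sup>2) = (\<Sum>e\<leftarrow>es. e ^ 4)"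
    unfolding of_real_hom.hom_sum_list map_map o_def using sq
    by (intro arg_cong[of _ _ sum_list] map_cong) auto
  also have "\<dots> = complex_of_real (trace_mat (S ^\<^sub>m 4))"
    by (simp add: trace_mat_pow_skew)
  also have "S ^\<^sub>m 4 = N * N"
    using S unfolding N_def skew
    by (simp add: numeral_eq_Suc assoc_mult_mat[of _ n n _ n _ n])
  also have "trace_mat (N * N) = (\<Sum>i = 0..<n. \<Sum>j = 0..<n. N $$ (i, j) * N $$ (j, i))"
    using S by (intro trace_mat_mult) (auto simp: N_def)
  also have "\<dots> = (\<Sum>i = 0..<n. \<Sum>j = 0..<n. (N $$ (i, j))\<^sup>2)"
  proof (intro sum.cong refl)
    fix i j assume "i \<in> {0..<n}" "j \<in> {0..<n}"
    then have "N $$ (j, i) = N $$ (i, j)"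
      using S unfolding N_def by (simp add: scalar_prod_def mult.commute)
    then show "N $$ (i, j) * N $$ (j, i) = (N $$ (i, j))\<^sup>2"
      by (simp add: power2_eq_square)
  qed
  finally show ?thesis by (simp only: of_real_eq_iff)
qed

text \<open>Both sides are quadratic polynomials in \<open>c\<close> with equal coefficients,
  determined by the squared Frobenius norm of \<open>N\<close>, its trace, and
  \<open>n\<close>.\<close>

lemma sum_norm_square_diff_skew_eigenvalues:
  defines "N \<equiv> transpose_mat S * S"
  shows "(\<Sum>e\<leftarrow>es. ((cmod e)\<^sup>2 - c)\<^sup>2)
    = (\<Sum>i = 0..<n. \<Sum>j = 0..<n. (N $$ (i, j) - (c \<cdot>\<^sub>m 1\<^sub>m n) $$ (i, j))\<^sup>2)"
proof -
  have "(\<Sum>j = 0..<n. (N $$ (i, j) - (c \<cdot>\<^sub>m 1\<^sub>m n) $$ (i, j))\<^sup>2)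
      = (\<Sum>j = 0..<n. (N $$ (i, j))\<^sup>2) - 2 * c * N $$ (i, i) + c\<^sup>2" if "i < n" for i
  proof -
    have "(\<Sum>j = 0..<n. (N $$ (i, j) - (c \<cdot>\<^sub>m 1\<^sub>m n) $$ (i, j))\<^sup>2)
        = (\<Sum>j = 0..<n. (N $$ (i, j))\<^sup>2 + (if j = i then c\<^sup>2 - 2 * c * N $$ (i, i) else 0))"
      using that by (intro sum.cong) (auto simp: power2_diff)
    then show ?thesis using that by (simp add: sum.distrib)
  qed
  then have "(\<Sum>i = 0..<n. \<Sum>j = 0..<n. (N $$ (i, j) - (c \<cdot>\<^sub>m 1\<^sub>m n) $$ (i, j))\<^sup>2)
      = (\<Sum>i = 0..<n. (\<Sum>j = 0..<n. (N $$ (i, j))\<^sup>2) - 2 * c * N $$ (i, i) + c\<^sup>2)"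
    by (intro sum.cong refl) (simp only: atLeastLessThan_iff)
  also have "\<dots> = (\<Sum>i = 0..<n. \<Sum>j = 0..<n. (N $$ (i, j))\<^sup>2)
      - 2 * c * (\<Sum>i = 0..<n. N $$ (i, i)) + real n * c\<^sup>2"
    by (simp add: sum.distrib sum_subtractf flip: sum_distrib_left)
  also have "(\<Sum>i = 0..<n. N $$ (i, i)) = trace_mat N"
    using S unfolding trace_mat_def by (simp add: N_def del: index_mult_mat(1))
  finally have "(\<Sum>i = 0..<n. \<Sum>j = 0..<n. (N $$ (i, j) - (c \<cdot>\<^sub>m 1\<^sub>m n) $$ (i, j))\<^sup>2)
      = (\<Sum>i = 0..<n. \<Sum>j = 0..<n. (N $$ (i, j))\<^sup>2) - 2 * c * trace_mat N + real n * c\<^sup>2" .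
  moreover have "(\<Sum>e\<leftarrow>es. ((cmod e)\<^sup>2 - c)\<^sup>2)
      = (\<Sum>e\<leftarrow>es. ((cmod e)\<^sup>2)\<^sup>2) - 2 * c * (\<Sum>e\<leftarrow>es. (cmod e)\<^sup>2) + real (length es) * c\<^sup>2"
    by (rule sum_list_diff_square)
  ultimately show ?thesis
    by (simp only: sum_norm_power4_skew_eigenvalues[folded N_def]
        sum_norm_square_skew_eigenvalues[folded N_def] length_skew_eigenvalues)
qed

text \<open>Each side states that a sum of squares vanishes: the squared Frobenius distance between
  the Gram matrix and the scalar matrix, or the squared deviations of the squared moduli from
  \<open>c\<close>. The two sums coincide.\<close>

lemma skew_gram_scalar_iff:
  "transpose_mat S * S = c \<cdot>\<^sub>m 1\<^sub>m n \<longleftrightarrow> (\<forall>e\<in>set es. (cmod e)\<^sup>2 = c)"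
proof -
  let ?d = "\<lambda>i j. (transpose_mat S * S) $$ (i, j) - (c \<cdot>\<^sub>m 1\<^sub>m n) $$ (i, j)"
  have "(\<forall>e\<in>set es. (cmod e)\<^sup>2 = c) \<longleftrightarrow> (\<Sum>e\<leftarrow>es. ((cmod e)\<^sup>2 - c)\<^sup>2) = 0"
    by (simp add: sum_list_square_eq_0_iff)
  also have "\<dots> \<longleftrightarrow> (\<Sum>i = 0..<n. \<Sum>j = 0..<n. (?d i j)\<^sup>2) = 0"
    by (simp only: sum_norm_square_diff_skew_eigenvalues)
  also have "\<dots> \<longleftrightarrow> (\<forall>i\<in>{0..<n}. (\<Sum>j = 0..<n. (?d i j)\<^sup>2) = 0)"
    by (rule sum_nonneg_eq_0_iff) (auto intro: sum_nonneg simp del: index_mult_mat)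
  also have "\<dots> \<longleftrightarrow> (\<forall>i\<in>{0..<n}. \<forall>j\<in>{0..<n}. (?d i j)\<^sup>2 = 0)"
    by (intro ball_cong refl sum_nonneg_eq_0_iff) simp_all
  also have "\<dots> \<longleftrightarrow> (\<forall>i<n. \<forall>j<n.
      (transpose_mat S * S) $$ (i, j) = (c \<cdot>\<^sub>m 1\<^sub>m n) $$ (i, j))"
    by (simp only: power_eq_0_iff right_minus_eq zero_less_numeral simp_thms
        Ball_def atLeastLessThan_iff zero_le)
  also have "\<dots> \<longleftrightarrow> transpose_mat S * S = c \<cdot>\<^sub>m 1\<^sub>m n"
    using S by (simp add: mat_eq_iff del: index_mult_mat(1))
  finally show ?thesis by (rule sym)
qed

section \<open>Criteria by spectral radius and by energy\<close>

text \<open>The trace condition makes \<open>c\<close> the mean of the squared moduli. If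
  \<open>c\<close> is also their maximum, none of them can lie below it.\<close>

lemma skew_gram_scalar_iff_spectral_radius:
  assumes "n > 0" and trace: "trace_mat (transpose_mat S * S) = real n * c"
  shows "transpose_mat S * S = c \<cdot>\<^sub>m 1\<^sub>m n
    \<longleftrightarrow> spectral_radius (map_mat complex_of_real S) = sqrt c"
proof -
  let ?A = "map_mat complex_of_real S"
  have A: "?A \<in> carrier_mat n n" using S by simp
  have spectrum: "spectrum ?A = set es"
    unfolding spectrum_root_char_poly[OF A] es by (auto simp: poly_prod_list)
  have mem: "spectral_radius ?A \<in> cmod ` set es"
    and ge: "\<And>e. e \<in> set es \<Longrightarrow> cmod e \<le> spectral_radius ?A"
    using spectral_radius_mem_max[OF A \<open>n > 0\<close>] unfolding spectrum by auto
  have "c \<ge> 0"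
  proof -
    have "0 \<le> real n * c"
      unfolding trace[symmetric] sum_norm_square_skew_eigenvalues[symmetric]
      by (rule sum_list_nonneg) auto
    then show ?thesis using \<open>n > 0\<close> by (simp add: zero_le_mult_iff)
  qed
  show ?thesis unfolding skew_gram_scalar_iff
  proof
    assume "\<forall>e\<in>set es. (cmod e)\<^sup>2 = c"
    with mem show "spectral_radius ?A = sqrt c" by (auto simp: real_sqrt_unique)
  next
    assume rho: "spectral_radius ?A = sqrt c"
    have le: "(cmod e)\<^sup>2 \<le> c" if "e \<in> set es" for e
      using ge[OF that] \<open>c \<ge> 0\<close> unfolding rho by (simp add: real_le_rsqrt sqrt_ge_absD)
    have "(\<Sum>e\<leftarrow>es. c - (cmod e)\<^sup>2) = 0"
      by (simp add: sum_list_subtractf sum_norm_square_skew_eigenvalues trace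
          sum_list_triv length_skew_eigenvalues)
    then show "\<forall>e\<in>set es. (cmod e)\<^sup>2 = c"
      using le by (subst (asm) sum_list_nonneg_eq_0_iff) auto
  qed
qed

text \<open>This is the equality case of Cauchy-Schwarz in explicit form: the total squared
  deviation of the moduli from \<open>sqrt c\<close> is \<open>2 * sqrt c\<close> times the gap
  between \<open>real n * sqrt c\<close> and their sum.\<close>

lemma skew_gram_scalar_iff_energy:
  assumes "c \<ge> 0" and trace: "trace_mat (transpose_mat S * S) = real n * c"
  shows "transpose_mat S * S = c \<cdot>\<^sub>m 1\<^sub>m n \<longleftrightarrow> (\<Sum>e\<leftarrow>es. cmod e) = real n * sqrt c"
proof -
  have "(\<Sum>e\<leftarrow>es. (cmod e - sqrt c)\<^sup>2)
      = real n * c - 2 * sqrt c * (\<Sum>e\<leftarrow>es. cmod e) + real n * (sqrt c)\<^sup>2"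
    by (simp only: sum_list_diff_square sum_norm_square_skew_eigenvalues trace
        length_skew_eigenvalues)
  also have "\<dots> = 2 * sqrt c * (real n * sqrt c - (\<Sum>e\<leftarrow>es. cmod e))"
  proof -
    \<comment> \<open>At \<open>s = sqrt c\<close>, the product \<open>s * s\<close> is collapsed to
      \<open>c\<close> afterwards, while the square written as a power stays as it is.\<close>
    have "N * (s * s) - 2 * s * E + N * s\<^sup>2 = 2 * s * (N * s - E)" for N s E :: real
      by (simp add: power2_eq_square algebra_simps)
    from this[of "real n" "sqrt c" "\<Sum>e\<leftarrow>es. cmod e"] show ?thesis
      unfolding real_sqrt_mult_self abs_of_nonneg[OF \<open>c \<ge> 0\<close>] .
  qed
  finally have var: "(\<Sum>e\<leftarrow>es. (cmod e - sqrt c)\<^sup>2)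
      = 2 * sqrt c * (real n * sqrt c - (\<Sum>e\<leftarrow>es. cmod e))" .
  have "(\<forall>e\<in>set es. (cmod e)\<^sup>2 = c) \<longleftrightarrow> (\<forall>e\<in>set es. cmod e = sqrt c)"
    using real_sqrt_unique[OF _ norm_ge_zero] real_sqrt_pow2[OF \<open>c \<ge> 0\<close>] by metis
  also have "\<dots> \<longleftrightarrow> (\<Sum>e\<leftarrow>es. cmod e) = real n * sqrt c"
  proof
    assume "\<forall>e\<in>set es. cmod e = sqrt c"
    then have "map cmod es = map (\<lambda>_. sqrt c) es" by simp
    then show "(\<Sum>e\<leftarrow>es. cmod e) = real n * sqrt c"
      by (simp only: sum_list_triv length_skew_eigenvalues)
  next
    assume "(\<Sum>e\<leftarrow>es. cmod e) = real n * sqrt c"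
    then have "(\<Sum>e\<leftarrow>es. (cmod e - sqrt c)\<^sup>2) = 0" unfolding var by simp
    then show "\<forall>e\<in>set es. cmod e = sqrt c"
      unfolding sum_list_square_eq_0_iff by simp
  qed
  finally show ?thesis unfolding skew_gram_scalar_iff .
qed

end

section \<open>Skew adjacency matrices of oriented regular graphs\<close>

text \<open>An orientation never contains an arc together with its reverse, so at most one of the
  two arc tests succeeds and exchanging the indices flips the sign.\<close>

lemma transpose_skew_adjacency_matrix:
  assumes "orientation_of G H"
  shows "transpose_mat (skew_adjacency_matrix H v n) = - skew_adjacency_matrix H v n"
proof -
  have "(w, u) \<notin> parcs H" if "(u, w) \<in> parcs H" for u w
    using assms that unfolding orientation_of_def by blast
  then show ?thesis
    unfolding skew_adjacency_matrix_def by (intro eq_matI) simp_all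
qed

text \<open>Squaring erases the signs, so the \<open>i\<close>-th diagonal entry of the Gram matrix
  counts the neighbours of \<open>v i\<close> in \<open>G\<close>.\<close>

lemma trace_gram_skew_adjacency_matrix:
  fixes v :: "nat \<Rightarrow> 'a"
  assumes "pair_graph G" and v: "bij_betw v {..<n} (pverts G)"
    and reg: "regular_graph G \<Delta>" and ori: "orientation_of G H"
  defines "S \<equiv> skew_adjacency_matrix H v n"
  shows "trace_mat (transpose_mat S * S) = real n * real \<Delta>"
proof -
  interpret pair_graph G by fact
  have S: "S \<in> carrier_mat n n" by (simp add: S_def skew_adjacency_matrix_def)
  have arc_iff: "(u, w) \<in> parcs G \<longleftrightarrow> (u, w) \<in> parcs H \<or> (w, u) \<in> parcs H" for u w
  proof -
    have "sym (parcs G)" using pair_sym_arcs by (simp add: symmetric_def)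
    then show ?thesis using ori unfolding orientation_of_def by (blast dest: symD)
  qed
  have "(\<Sum>k = 0..<n. S $$ (k, i) * S $$ (k, i)) = real \<Delta>" if "i < n" for i
  proof -
    have "(\<Sum>k = 0..<n. S $$ (k, i) * S $$ (k, i))
        = (\<Sum>k\<in>{0..<n}. if (v i, v k) \<in> parcs G then 1 else 0)"
      using that by (intro sum.cong) (auto simp: arc_iff S_def skew_adjacency_matrix_def)
    also have "\<dots> = real (card {k \<in> {0..<n}. (v i, v k) \<in> parcs G})"
      by (simp add: sum.If_cases Int_def)
    \<comment> \<open>Heads of arcs are vertices and hence enumerated by \<open>v\<close>, so
      indices of neighbours correspond to outgoing arcs.\<close>
    also have "card {k \<in> {0..<n}. (v i, v k) \<in> parcs G} = card (out_arcs (with_proj G) (v i))"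
    proof (rule bij_betw_same_card[of "\<lambda>k. (v i, v k)"])
      have "inj_on v {..<n}" and img: "v ` {..<n} = pverts G"
        using v by (auto simp: bij_betw_def)
      moreover have "\<exists>k<n. w = v k" if "(u, w) \<in> parcs G" for u w
        using in_arcsD2[OF that] unfolding img[symmetric] by auto
      ultimately show "bij_betw (\<lambda>k. (v i, v k)) {k \<in> {0..<n}. (v i, v k) \<in> parcs G}
          (out_arcs (with_proj G) (v i))"
        by (fastforce simp: bij_betw_def inj_on_def out_arcs_def)
    qed
    also have "\<dots> = \<Delta>"
      using reg that v unfolding regular_graph_def out_degree_def bij_betw_def by auto
    finally show ?thesis .
  qed
  then show ?thesis
    using S trace_mat_mult[of "transpose_mat S" n n S] by simp
qed

lemma max_degree_regular_graph:
  assumes "regular_graph G \<Delta>" "pverts G \<noteq> {}"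
  shows "max_degree G = \<Delta>"
proof -
  have "out_degree (with_proj G) ` pverts G = {\<Delta>}"
    using assms unfolding regular_graph_def by auto
  then show ?thesis by (simp add: max_degree_def)
qed

theorem theorem3p2:
  fixes G H :: "'a pair_pre_digraph"
    and v :: "nat \<Rightarrow> 'a"
    and n \<Delta> :: nat
    and S :: "real mat"
  assumes "pair_graph G"
    and "n > 0"
    and "bij_betw v {..<n} (pverts G)"
    and "regular_graph G \<Delta>"
    and "orientation_of G H"
    and "S = skew_adjacency_matrix H v n"
  shows "(skew_spectral_radius H v n = sqrt (real \<Delta>)
            \<longleftrightarrow> transpose_mat S * S = real \<Delta> \<cdot>\<^sub>m 1\<^sub>m n)
       \<and> (transpose_mat S * S = real \<Delta> \<cdot>\<^sub>m 1\<^sub>m n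
            \<longleftrightarrow> optimum_skew_energy G H v n)
       \<and> (optimum_skew_energy G H v n
            \<longleftrightarrow> skew_energy H v n = real n * sqrt (real \<Delta>))"
proof -
  have S: "S \<in> carrier_mat n n"
    using assms(6) by (simp add: skew_adjacency_matrix_def)
  have skew: "transpose_mat S = - S"
    using transpose_skew_adjacency_matrix[OF assms(5)] assms(6) by simp
  have "map_mat complex_of_real S \<in> carrier_mat n n" using S by simp
  from char_poly_factorized[OF this] obtain es
    where es: "char_poly (map_mat complex_of_real S) = (\<Prod>e\<leftarrow>es. [:- e, 1:])" by blast
  have trace: "trace_mat (transpose_mat S * S) = real n * real \<Delta>"
    using trace_gram_skew_adjacency_matrix[OF assms(1,3,4,5)] assms(6) by simp
  \<comment> \<open>Identifies the multiset underlying \<open>skew_energy\<close> with the list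
    \<open>es\<close>; splitting off a linear factor requires the remaining product to be
    nonzero.\<close>
  have "proots (\<Prod>e\<leftarrow>es. [:- e, 1:]) = mset es"
  proof (induction es)
    case (Cons e es)
    have "(\<Prod>e\<leftarrow>es. [:- e, 1:]) \<noteq> 0"
      by auto
    then show ?case
      using Cons.IH by (simp add: proots_mult del: mult_pCons_left)
  qed simp
  then have energy: "skew_energy H v n = (\<Sum>e\<leftarrow>es. cmod e)"
    unfolding skew_energy_def assms(6)[symmetric] es by (simp flip: mset_map sum_mset_sum_list)
  \<comment> \<open>With a vertex present, the set of degrees is a singleton rather than empty, so
    its \<open>Max\<close> is \<open>\<Delta>\<close>.\<close>
  have "pverts G \<noteq> {}"
    using assms(2,3) by (auto simp: bij_betw_def)
  then have "max_degree G = \<Delta>"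
    using max_degree_regular_graph[OF assms(4)] by simp
  then show ?thesis
    using skew_gram_scalar_iff_spectral_radius[OF S skew es assms(2) trace]
      skew_gram_scalar_iff_energy[OF S skew es _ trace] assms(6)
    by (simp add: optimum_skew_energy_def energy skew_spectral_radius_def)
qed

end
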